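(* Let $\mathcal{A}\subset\mathbb{R}^n$ be a bounded set and let $\mathcal{O}$ be an open subset of $\mathbb{R}^n$ containing $\overline{\mathcal{A}}$ which, equipped with the subspace topology of $\mathbb{R}^n$, is a contractible space. Let $\tau^*:\mathcal{O}\to\tau^*(\mathcal{O})\subset\mathbb{R}^m$ be a $C^1$ injective immersion. Then there exists a $C^1$ function $\gamma:\mathcal{O}\to\mathbb{R}^{m\times(m-n)}$ such that, for any bounded open set $\tilde{\mathcal{O}}$ satisfying $$\overline{\mathcal{A}}\subset\tilde{\mathcal{O}}\subset\overline{\tilde{\mathcal{O}}}\subset\mathcal{O},$$ there exists a real number $\varepsilon>0$ such that, with $$\tau_a^*(x,w)=\tau^*(x)+\gamma(x)\,w,\qquad \mathcal{O}_a=\tilde{\mathcal{O}}\times\mathcal{B}_\varepsilon(0),$$ the set $\mathcal{O}_a$ is an open subset of $\mathbb{R}^m$ containing the closure of $\mathcal{A}\times\{0\}$ and $\tau_a^*:\mathcal{O}_a\to\tau_a^*(\mathcal{O}_a)\subset\mathbb{R}^m$ is a diffeomorphism satisfying $\tau_a^*(x,0)=\tau^*(x)$ for all $x\in\mathcal{A}$.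
   Context: Here $m>n$. Overline denotes closure. $\mathcal{B}_\varepsilon(0)$ is the open ball of radius $\varepsilon$ centered at $0$ in $\mathbb{R}^{m-n}$, and $\mathbb{R}^m$ is identified with $\mathbb{R}^n\times\mathbb{R}^{m-n}$. Diffeomorphisms are $C^1$ diffeomorphisms onto their image. *)

theory Defs
  imports "HOL-Analysis.Analysis"
begin

text \<open>
  These notions are meant for open \<open>S\<close>, where \<open>at x\<close> and \<open>at x within S\<close> agree; the derivative is
  continuous as a map into the space of linear maps with the operator norm.
\<close>

definition C1_on ::
  "'a::euclidean_space set \<Rightarrow> ('a \<Rightarrow> 'b::euclidean_space) \<Rightarrow> bool" where
  "C1_on S f \<longleftrightarrow>
     (\<exists>f' :: 'a \<Rightarrow> 'a \<Rightarrow>\<^sub>L 'b.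
        (\<forall>x\<in>S. (f has_derivative blinfun_apply (f' x)) (at x)) \<and> continuous_on S f')"

definition C1_immersion_on ::
  "'a::euclidean_space set \<Rightarrow> ('a \<Rightarrow> 'b::euclidean_space) \<Rightarrow> bool" where
  "C1_immersion_on S f \<longleftrightarrow>
     C1_on S f \<and> (\<forall>x\<in>S. inj (frechet_derivative f (at x)))"

definition C1_diffeomorphism ::
  "'a::euclidean_space set \<Rightarrow> 'b::euclidean_space set \<Rightarrow> ('a \<Rightarrow> 'b) \<Rightarrow> bool" where
  "C1_diffeomorphism S T f \<longleftrightarrow>
     open S \<and> open T \<and> C1_on S f \<and> (\<exists>g. homeomorphism S T f g \<and> C1_on T g)"

end

theory Submission
  imports Defs
begin

text \<open>
  The orthogonal projections onto the normal spaces of the immersion depend continuously on the point, so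
  a frame of one normal space can be transported along a contraction of \<open>\<O>\<close> to a continuous frame
  \<open>F\<close> of the whole normal bundle. The matrices \<open>A\<close> with \<open>F x w \<bullet> (A *v w) > 0\<close> for all \<open>w \<noteq> 0\<close> form a
  convex open set of complements of the tangent space at \<open>x\<close>, so polynomial approximations of \<open>F\<close> on
  compact sets can be glued to a \<open>\<gamma>\<close> of class C1. The derivative of \<open>\<tau> x + \<gamma> x *v w\<close> is then
  invertible at \<open>w = 0\<close>, and injectivity on the compact set \<open>closure \<O>\<^sub>t \<times> {0}\<close> extends to a neighbourhood.
\<close>

section \<open>Maps of class C1\<close>

text \<open>In finite dimension, continuity of \<open>f' x v\<close> for each fixed \<open>v\<close>
  already gives continuity in the operator norm, so derivatives can be handled as plain functions.
  \<open>Blinfun (f' x)\<close> represents \<open>f' x\<close> only where \<open>f' x\<close> is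
  bounded linear, which is known on \<open>S\<close>.\<close>

lemma C1_onI:
  fixes f :: "'a::euclidean_space \<Rightarrow> 'b::euclidean_space"
  assumes der: "\<And>x. x \<in> S \<Longrightarrow> (f has_derivative f' x) (at x)"
    and cont: "\<And>v. continuous_on S (\<lambda>x. f' x v)"
  shows "C1_on S f"
proof -
  have app: "blinfun_apply (Blinfun (f' x)) = f' x" if "x \<in> S" for x
    using der[OF that] by (simp add: bounded_linear_Blinfun_apply has_derivative_bounded_linear)
  show ?thesis
    unfolding C1_on_def
  proof (intro exI[of _ "\<lambda>x. Blinfun (f' x)"] conjI ballI)
    show "(f has_derivative blinfun_apply (Blinfun (f' x))) (at x)" if "x \<in> S" for x
      using app der that by simp
    show "continuous_on S (\<lambda>x. Blinfun (f' x))"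
    proof (rule continuous_on_blinfun_componentwise)
      show "continuous_on S (\<lambda>x. blinfun_apply (Blinfun (f' x)) i)" for i
        by (rule continuous_on_eq[OF cont[of i]]) (simp add: app)
    qed
  qed
qed

lemma C1_on_imp_continuous_on: "C1_on S f \<Longrightarrow> continuous_on S f"
  unfolding C1_on_def
  by (meson continuous_at_imp_continuous_on has_derivative_continuous)

lemma C1_on_subset: "C1_on S f \<Longrightarrow> T \<subseteq> S \<Longrightarrow> C1_on T f"
  unfolding C1_on_def by (meson continuous_on_subset subsetD)

lemma C1_on_bounded_linear: "bounded_linear f \<Longrightarrow> C1_on S f"
  by (rule C1_onI[where f' = "\<lambda>_. f"]) (auto intro: bounded_linear_imp_has_derivative)

lemma C1_on_const: "C1_on S (\<lambda>x. c)"
  by (rule C1_onI[where f' = "\<lambda>_ _. 0"]) auto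

lemma C1_on_compose:
  assumes f: "C1_on S f" and g: "C1_on T g" and "f ` S \<subseteq> T"
  shows "C1_on S (\<lambda>x. g (f x))"
proof -
  obtain f' where f': "\<And>x. x \<in> S \<Longrightarrow> (f has_derivative blinfun_apply (f' x)) (at x)"
      "continuous_on S f'"
    using f unfolding C1_on_def by blast
  obtain g' where g': "\<And>y. y \<in> T \<Longrightarrow> (g has_derivative blinfun_apply (g' y)) (at y)"
      "continuous_on T g'"
    using g unfolding C1_on_def by blast
  have "((\<lambda>x. g (f x)) has_derivative blinfun_apply (g' (f x) o\<^sub>L f' x)) (at x)" if "x \<in> S" for x
    using has_derivative_compose[OF f'(1) g'(1)] assms(3) that
    by (auto simp: blinfun_apply_blinfun_compose[abs_def])
  moreover have "continuous_on S (\<lambda>x. g' (f x) o\<^sub>L f' x)"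
    using continuous_on_compose2[OF g'(2) C1_on_imp_continuous_on[OF f] assms(3)]
    by (intro continuous_intros f')
  ultimately show ?thesis
    unfolding C1_on_def by (intro exI[of _ "\<lambda>x. g' (f x) o\<^sub>L f' x"]) blast
qed

lemma C1_on_bilinear:
  assumes h: "bounded_bilinear h" and f: "C1_on S f" and g: "C1_on S g"
  shows "C1_on S (\<lambda>x. h (f x) (g x))"
proof -
  obtain f' where f': "\<And>x. x \<in> S \<Longrightarrow> (f has_derivative blinfun_apply (f' x)) (at x)"
      "continuous_on S f'"
    using f unfolding C1_on_def by blast
  obtain g' where g': "\<And>x. x \<in> S \<Longrightarrow> (g has_derivative blinfun_apply (g' x)) (at x)"
      "continuous_on S g'"
    using g unfolding C1_on_def by blast
  note [continuous_intros] = C1_on_imp_continuous_on[OF f] C1_on_imp_continuous_on[OF g] f'(2) g'(2)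
  show ?thesis
  proof (rule C1_onI)
    show "((\<lambda>x. h (f x) (g x)) has_derivative (\<lambda>v. h (f x) (g' x v) + h (f' x v) (g x))) (at x)"
      if "x \<in> S" for x
      using bounded_bilinear.FDERIV[OF h f'(1) g'(1)] that by blast
    show "continuous_on S (\<lambda>x. h (f x) (g' x v) + h (f' x v) (g x))" for v
      by (intro continuous_intros bounded_bilinear.continuous_on[OF h])
  qed
qed

lemma C1_on_add:
  assumes f: "C1_on S f" and g: "C1_on S g"
  shows "C1_on S (\<lambda>x. f x + g x)"
proof -
  obtain f' where f': "\<And>x. x \<in> S \<Longrightarrow> (f has_derivative blinfun_apply (f' x)) (at x)"
      "continuous_on S f'"
    using f unfolding C1_on_def by blast
  obtain g' where g': "\<And>x. x \<in> S \<Longrightarrow> (g has_derivative blinfun_apply (g' x)) (at x)"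
      "continuous_on S g'"
    using g unfolding C1_on_def by blast
  show ?thesis
    by (rule C1_onI[where f' = "\<lambda>x v. f' x v + g' x v"])
      (auto intro!: has_derivative_add f' g' continuous_intros)
qed

lemma C1_on_diff:
  assumes "C1_on S f" and "C1_on S g"
  shows "C1_on S (\<lambda>x. f x - g x)"
proof -
  have "C1_on S (\<lambda>x. - g x)"
    by (rule C1_on_compose[OF assms(2) C1_on_bounded_linear
          [OF bounded_linear_minus[OF bounded_linear_ident], of UNIV]]) simp
  from C1_on_add[OF assms(1) this] show ?thesis by simp
qed

lemma C1_on_sum: "(\<And>i. i \<in> I \<Longrightarrow> C1_on S (f i)) \<Longrightarrow> C1_on S (\<lambda>x. \<Sum>i\<in>I. f i x)"
  by (induction I rule: infinite_finite_induct) (auto intro: C1_on_const C1_on_add)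

text \<open>Derivatives are unique, so the derivatives of the local representatives all coincide
  with \<open>frechet_derivative f\<close> and glue to one continuous map.\<close>

lemma C1_on_locally:
  assumes "\<And>x. x \<in> S \<Longrightarrow> \<exists>T g. open T \<and> x \<in> T \<and> C1_on T g \<and> (\<forall>y\<in>T. f y = g y)"
  shows "C1_on S f"
proof -
  have loc: "\<exists>T f'. open T \<and> x \<in> T \<and> continuous_on T f' \<and>
      (\<forall>y\<in>T. (f has_derivative blinfun_apply (f' y)) (at y))" if x: "x \<in> S" for x
  proof -
    obtain T g where T: "open T" "x \<in> T" "C1_on T g" "\<forall>y\<in>T. f y = g y"
      using assms[OF x] by blast
    obtain g' where g': "\<And>y. y \<in> T \<Longrightarrow> (g has_derivative blinfun_apply (g' y)) (at y)"
        "continuous_on T g'"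
      using T(3) unfolding C1_on_def by blast
    have "(f has_derivative blinfun_apply (g' y)) (at y)" if "y \<in> T" for y
      using has_derivative_transform_within_open[OF g'(1) T(1)] T(4) that by force
    with T g' show ?thesis by blast
  qed
  define F where "F x = frechet_derivative f (at x)" for x
  have F: "blinfun_apply f' = F y"
    if "(f has_derivative blinfun_apply f') (at y)" for f' y
    using frechet_derivative_at[OF that] F_def by simp
  show ?thesis
  proof (rule C1_onI[where f' = F])
    show "(f has_derivative F x) (at x)" if "x \<in> S" for x
    proof -
      obtain f' where "(f has_derivative blinfun_apply f') (at x)"
        using loc[OF \<open>x \<in> S\<close>] by blast
      with F[OF this] show ?thesis by simp
    qed
    show "continuous_on S (\<lambda>x. F x v)" for v
    proof (rule continuous_at_imp_continuous_on, rule ballI)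
      fix x assume "x \<in> S"
      then obtain T f' where T: "open T" "x \<in> T" "continuous_on T f'"
          "\<And>y. y \<in> T \<Longrightarrow> (f has_derivative blinfun_apply (f' y)) (at y)"
        using loc[OF \<open>x \<in> S\<close>] by blast
      have "continuous_on T (\<lambda>y. f' y v)"
        by (intro continuous_intros T)
      then have "continuous_on T (\<lambda>y. F y v)"
        by (rule continuous_on_eq) (simp add: F[OF T(4)])
      then show "isCont (\<lambda>y. F y v) x"
        using T(1,2) continuous_on_eq_continuous_at by blast
    qed
  qed
qed

section \<open>Polynomials and a step function of class C1\<close>

lemma C1_on_real_polynomial_function:
  fixes p :: "'a::euclidean_space \<Rightarrow> real"
  shows "real_polynomial_function p \<Longrightarrow> C1_on S p"
  by (induction rule: real_polynomial_function.induct)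
    (auto intro: C1_on_bounded_linear C1_on_const C1_on_add
      C1_on_bilinear[OF bounded_bilinear_mult])

lemma C1_on_polynomial_function:
  fixes p :: "'a::euclidean_space \<Rightarrow> 'b::euclidean_space"
  assumes "polynomial_function p"
  shows "C1_on S p"
proof -
  have "C1_on S (\<lambda>x. \<Sum>b\<in>Basis. (p x \<bullet> b) *\<^sub>R b)"
    using assms
    by (intro C1_on_sum C1_on_bilinear[OF bounded_bilinear_scaleR] C1_on_const
        C1_on_real_polynomial_function) (auto simp: polynomial_function_iff_Basis_inner)
  then show ?thesis
    by (simp add: euclidean_representation)
qed

lemma C1_on_max_power2: "C1_on S (\<lambda>t::real. (max 0 t)\<^sup>2)"
proof (rule C1_onI)
  show "((\<lambda>t. (max 0 t)\<^sup>2) has_derivative (\<lambda>v. 2 * max 0 t * v)) (at t)" for t :: real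
  proof -
    consider "t < 0" | "t = 0" | "t > 0" by linarith
    then have "((\<lambda>t. (max 0 t)\<^sup>2) has_real_derivative 2 * max 0 t) (at t)"
    proof cases
      case 1
      have "((\<lambda>t. 0) has_real_derivative 2 * max 0 t) (at t)"
        using 1 by simp
      then show ?thesis
        by (rule has_field_derivative_transform_within_open[of _ _ _ "{..<0}"]) (use 1 in auto)
    next
      case 2
      \<comment> \<open>The difference quotient at 0; the equation includes \<open>h = 0\<close>
        because division by zero yields 0.\<close>
      have "(\<lambda>h. (max 0 h)\<^sup>2 / h) = (\<lambda>h::real. max 0 h)"
        by (auto simp: fun_eq_iff max_def power2_eq_square)
      moreover have "(\<lambda>h::real. max 0 h) \<midarrow>0\<rightarrow> max 0 0"
        by (intro tendsto_intros)
      ultimately show ?thesis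
        using 2 by (simp add: DERIV_def)
    next
      case 3
      have "((\<lambda>t. t\<^sup>2) has_real_derivative 2 * max 0 t) (at t)"
        using 3 by (auto intro!: derivative_eq_intros)
      then show ?thesis
        by (rule has_field_derivative_transform_within_open[of _ _ _ "{0<..}"]) (use 3 in auto)
    qed
    then show ?thesis
      by (simp add: has_field_derivative_def)
  qed
  show "continuous_on S (\<lambda>t::real. 2 * max 0 t * v)" for v
    by (intro continuous_intros)
qed

text \<open>The step \<open>1 - q (1 - q t)\<close> with \<open>q t = (max 0 t)\<^sup>2\<close> avoids a piecewise definition.\<close>

lemma C1_step_function:
  obtains s :: "real \<Rightarrow> real"
  where "\<And>S. C1_on S s" "\<And>t. 0 \<le> s t" "\<And>t. s t \<le> 1"
    "\<And>t. t \<le> 0 \<Longrightarrow> s t = 0" "\<And>t. 1 \<le> t \<Longrightarrow> s t = 1"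
proof
  define q :: "real \<Rightarrow> real" where "q t = (max 0 t)\<^sup>2" for t
  have q: "C1_on S q" for S
    using C1_on_max_power2 by (simp add: q_def[abs_def])
  show "C1_on S (\<lambda>t. 1 - q (1 - q t))" for S
    by (intro C1_on_diff C1_on_const q C1_on_compose[where g = q and T = UNIV]) auto
  have "0 \<le> q t" for t by (simp add: q_def)
  then show "0 \<le> 1 - q (1 - q t)" for t
    by (simp add: q_def power_le_one)
  show "1 - q (1 - q t) \<le> 1" for t by (simp add: q_def)
  show "1 - q (1 - q t) = 0" if "t \<le> 0" for t using that by (simp add: q_def)
  show "1 - q (1 - q t) = 1" if "1 \<le> t" for t
    using that by (simp add: q_def)
qed

section \<open>Smoothing of continuous selections\<close>

text \<open>A step function applied to a polynomial approximation of a Urysohn function. The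
  approximation is uniform only on the compact set \<open>L\<close>, hence the restrictions to
  \<open>L\<close> in the last two properties.\<close>

lemma C1_cutoff:
  fixes K L U :: "'a::euclidean_space set"
  assumes "compact L" "compact K" "K \<subseteq> U" "open U"
  obtains \<psi> :: "'a \<Rightarrow> real"
  where "C1_on UNIV \<psi>" "\<And>x. 0 \<le> \<psi> x" "\<And>x. \<psi> x \<le> 1"
    "\<And>x. x \<in> K \<inter> L \<Longrightarrow> \<psi> x = 1" "\<And>x. x \<in> L - U \<Longrightarrow> \<psi> x = 0"
proof -
  \<comment> \<open>The values 2 and -1 lie one unit beyond the thresholds 1 and 0 of the step, so
    an error below 1 is harmless.\<close>
  obtain u :: "'a \<Rightarrow> real" where u: "continuous_on UNIV u"
      "\<And>x. x \<in> K \<Longrightarrow> u x = 2" "\<And>x. x \<in> - U \<Longrightarrow> u x = -1"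
    using Urysohn[of K "- U" "2::real" "-1"] assms(2,3,4)
    by (metis Diff_Compl Diff_eq_empty_iff closed_Compl compact_imp_closed disjoint_eq_subset_Compl
        double_complement)
  obtain p where p: "polynomial_function p" "\<And>x. x \<in> L \<Longrightarrow> \<bar>u x - p x\<bar> < 1"
    using Stone_Weierstrass_polynomial_function[OF \<open>compact L\<close>, of u 1] u(1)
    by (auto intro: continuous_on_subset)
  obtain s :: "real \<Rightarrow> real" where s: "\<And>S. C1_on S s" "\<And>t. 0 \<le> s t" "\<And>t. s t \<le> 1"
    "\<And>t. t \<le> 0 \<Longrightarrow> s t = 0" "\<And>t. 1 \<le> t \<Longrightarrow> s t = 1"
    using C1_step_function by metis
  show ?thesis
  proof (rule that[of "\<lambda>x. s (p x)"])
    show "C1_on UNIV (\<lambda>x. s (p x))"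
      by (rule C1_on_compose[OF C1_on_polynomial_function[OF p(1)] s(1)[of UNIV]]) simp
    show "s (p x) = 1" if "x \<in> K \<inter> L" for x
      using p(2)[of x] u(2)[of x] that by (intro s(5)) auto
    show "s (p x) = 0" if "x \<in> L - U" for x
      using p(2)[of x] u(3)[of x] that by (intro s(4)) auto
  qed (auto simp: s)
qed

text \<open>Inductive step of an exhaustion argument: a cutoff that is 1 on \<open>K\<close> and 0
  on \<open>M\<close> off the interior of \<open>L\<close> blends \<open>g\<close> with a polynomial
  selection on \<open>M\<close>. Convexity keeps the blend in \<open>G x\<close> where both are
  selections; elsewhere on \<open>M\<close> only the polynomial remains.\<close>

lemma C1_selection_step:
  fixes g :: "'a::euclidean_space \<Rightarrow> 'b::euclidean_space"
  assumes conv: "\<And>x. convex (G x)"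
    and appr: "\<exists>p. polynomial_function p \<and> (\<forall>x\<in>M. p x \<in> G x)"
    and M: "compact K" "K \<subseteq> interior L" "compact L" "L \<subseteq> M" "compact M"
    and g: "C1_on UNIV g" "\<And>x. x \<in> L \<Longrightarrow> g x \<in> G x"
  shows "\<exists>g'. C1_on UNIV g' \<and> (\<forall>x\<in>M. g' x \<in> G x) \<and> (\<forall>x\<in>K. g' x = g x)"
proof -
  obtain p where p: "polynomial_function p" "\<And>x. x \<in> M \<Longrightarrow> p x \<in> G x"
    using appr by blast
  obtain \<psi> :: "'a \<Rightarrow> real" where \<psi>: "C1_on UNIV \<psi>" "\<And>x. 0 \<le> \<psi> x" "\<And>x. \<psi> x \<le> 1"
    "\<And>x. x \<in> K \<inter> M \<Longrightarrow> \<psi> x = 1" "\<And>x. x \<in> M - interior L \<Longrightarrow> \<psi> x = 0"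
    using C1_cutoff[OF M(5,1,2) open_interior] by blast
  let ?g = "\<lambda>x. p x + \<psi> x *\<^sub>R (g x - p x)"
  have "C1_on UNIV ?g"
    by (intro C1_on_add C1_on_diff C1_on_bilinear[OF bounded_bilinear_scaleR]
        C1_on_polynomial_function p g \<psi>)
  moreover have "?g x \<in> G x" if "x \<in> M" for x
  proof (cases "x \<in> interior L")
    case True
    then have "(1 - \<psi> x) *\<^sub>R p x + \<psi> x *\<^sub>R g x \<in> G x"
      using interior_subset[of L] \<psi>(2,3) p(2) g(2) that by (intro convexD[OF conv]) auto
    then show ?thesis by (simp add: algebra_simps)
  next
    case False
    then show ?thesis using \<psi>(5) p(2) that by simp
  qed
  moreover have "?g x = g x" if "x \<in> K" for x
  proof -
    have "x \<in> M"
      using that M interior_subset[of L] by blast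
    then show ?thesis using \<psi>(4)[of x] that by simp
  qed
  ultimately show ?thesis by blast
qed

text \<open>On each compact set of an exhaustion, \<open>room\<close> lets a polynomial
  approximation of \<open>F\<close> serve as a selection. Repeated blending gives a sequence that
  becomes stationary on every compact set of the exhaustion, so its limit is locally one of its
  members.\<close>

lemma C1_selection:
  fixes G :: "'a::euclidean_space \<Rightarrow> 'b::euclidean_space set"
  assumes "open S" and F: "continuous_on S F"
    and conv: "\<And>x. convex (G x)"
    and room: "\<And>K. compact K \<Longrightarrow> K \<subseteq> S \<Longrightarrow> \<exists>e>0. \<forall>x\<in>K. ball (F x) e \<subseteq> G x"
  shows "\<exists>g. C1_on S g \<and> (\<forall>x\<in>S. g x \<in> G x)"
proof -
  obtain C where C: "\<And>n. compact (C n)" "\<And>n. C n \<subseteq> S" "\<And>n. C n \<subseteq> interior (C (Suc n))"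
      "\<Union> (range C) = S"
    using open_Union_compact_subsets[OF \<open>open S\<close>] by metis
  have appr: "\<exists>p. polynomial_function p \<and> (\<forall>x\<in>C n. p x \<in> G x)" for n
  proof -
    obtain e where e: "e > 0" "\<And>x. x \<in> C n \<Longrightarrow> ball (F x) e \<subseteq> G x"
      using room[OF C(1)[of n] C(2)] by blast
    obtain p where "polynomial_function p" "\<And>x. x \<in> C n \<Longrightarrow> norm (F x - p x) < e"
      using Stone_Weierstrass_polynomial_function[OF C(1)[of n] continuous_on_subset[OF F C(2)] e(1)]
      by blast
    with e(2) show ?thesis
      by (metis dist_norm mem_ball subsetD)
  qed
  have mono: "C n \<subseteq> C (Suc n)" for n
    using C(3) interior_subset by blast
  \<comment> \<open>The selection property reaches one index beyond the set \<open>C n\<close> on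
    which later functions must agree with \<open>g\<close>; the cutoff decays in between.\<close>
  define P where "P n g \<longleftrightarrow> C1_on UNIV g \<and> (\<forall>x\<in>C (Suc n). g x \<in> G x)" for n g
  have "\<exists>f. \<forall>n. P n (f n) \<and> (\<forall>x\<in>C n. f (Suc n) x = f n x)"
  proof (rule dependent_nat_choice)
    show "\<exists>g. P 0 g"
      using appr C1_on_polynomial_function unfolding P_def by metis
    show "\<exists>g'. P (Suc n) g' \<and> (\<forall>x\<in>C n. g' x = g x)" if "P n g" for g n
      using C1_selection_step[OF conv appr C(1) C(3) C(1) mono C(1)] that unfolding P_def by blast
  qed
  then obtain f where f: "\<And>n. P n (f n)" "\<And>n x. x \<in> C n \<Longrightarrow> f (Suc n) x = f n x"
    by blast
  have mono': "C m \<subseteq> C n" if "m \<le> n" for m n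
    using lift_Suc_mono_le[of C m n] mono that by blast
  have stable: "f n x = f m x" if "x \<in> C m" "m \<le> n" for x m n
    using that(2)
  proof (induction n rule: dec_induct)
    case (step n)
    then show ?case using f(2)[of x n] mono'[of m n] that(1) by auto
  qed simp
  define g where "g x = f (LEAST n. x \<in> C n) x" for x
  have g: "g x = f n x" if "x \<in> C n" for n x
    unfolding g_def using stable[OF LeastI[of "\<lambda>n. x \<in> C n", OF that] Least_le[of "\<lambda>n. x \<in> C n", OF that]]
    by simp
  have "C1_on S g"
  proof (rule C1_on_locally)
    fix x assume "x \<in> S"
    then obtain n where n: "x \<in> C n"
      using C(4) by blast
    show "\<exists>T h. open T \<and> x \<in> T \<and> C1_on T h \<and> (\<forall>y\<in>T. g y = h y)"
      using C(3) n f(1)[of "Suc n"] g[of _ "Suc n"] interior_subset[of "C (Suc n)"]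
      by (intro exI[of _ "interior (C (Suc n))"] exI[of _ "f (Suc n)"])
        (auto simp: P_def intro: C1_on_subset)
  qed
  moreover have "g x \<in> G x" if "x \<in> S" for x
  proof -
    obtain n where "x \<in> C n"
      using C(4) \<open>x \<in> S\<close> by blast
    then show ?thesis
      using g f(1)[of n] subsetD[OF mono] unfolding P_def by auto
  qed
  ultimately show ?thesis by blast
qed

section \<open>Injective immersions\<close>

lemma linear_blinfun_apply: "linear (blinfun_apply A)"
  by (simp add: blinfun.bounded_linear_right bounded_linear.linear)

text \<open>If \<open>A\<close> is bounded below by \<open>b\<close>, a perturbation of norm less
  than \<open>b / 2\<close> loses at most half of this bound. Thus \<open>b / 2\<close> serves both
  as radius and as common lower bound.\<close>

lemma blinfun_inj_bounded_below:
  fixes A :: "'a::euclidean_space \<Rightarrow>\<^sub>L 'b::euclidean_space"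
  assumes "inj A"
  obtains c where "c > 0" "\<And>B v. norm (B - A) < c \<Longrightarrow> c * norm v \<le> norm (blinfun_apply B v)"
proof -
  obtain b where b: "b > 0" "\<And>v. b * norm v \<le> norm (A v)"
    using linear_inj_bounded_below_pos[OF linear_blinfun_apply assms] by blast
  show ?thesis
  proof (rule that[of "b / 2"])
    show "b / 2 * norm v \<le> norm (blinfun_apply B v)" if "norm (B - A) < b / 2" for B v
    proof -
      have "norm (B v - A v) \<le> norm (B - A) * norm v"
        using norm_blinfun[of "B - A" v] by (simp add: blinfun.diff_left)
      also have "\<dots> \<le> b / 2 * norm v"
        using that by (intro mult_right_mono) auto
      finally show ?thesis
        using b(2)[of v] norm_triangle_ineq2[of "A v" "B v"] by (simp add: norm_minus_commute)
    qed
  qed (use b in auto)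
qed

lemma blinfun_inj_near:
  fixes A :: "'a::euclidean_space \<Rightarrow>\<^sub>L 'b::euclidean_space"
  assumes "inj A"
  obtains c where "c > 0" "\<And>B. norm (B - A) < c \<Longrightarrow> inj (blinfun_apply B)"
proof -
  obtain c where c: "c > 0" "\<And>B v. norm (B - A) < c \<Longrightarrow> c * norm v \<le> norm (blinfun_apply B v)"
    using blinfun_inj_bounded_below[OF assms] by blast
  have "inj (blinfun_apply B)" if "norm (B - A) < c" for B
  proof (rule injI)
    fix x y assume "blinfun_apply B x = blinfun_apply B y"
    then have "c * norm (x - y) \<le> 0"
      using c(2)[OF that, of "x - y"] by (simp add: blinfun.diff_right)
    then show "x = y"
      using c(1) by (simp add: mult_le_0_iff)
  qed
  with c(1) that show ?thesis by blast
qed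

text \<open>The uniform lower bound near \<open>x\<close> gives
  \<open>c * norm (u y - u x) \<le> norm (b y - L y (u x))\<close>, whose right side tends to 0.
  This replaces continuity of operator inversion, both for normal equations and for the derivative
  of an inverse map.\<close>

lemma continuous_on_linear_solution:
  fixes L :: "'x::topological_space \<Rightarrow> 'a::euclidean_space \<Rightarrow>\<^sub>L 'b::euclidean_space"
  assumes L: "continuous_on S L" "\<And>x. x \<in> S \<Longrightarrow> inj (L x)"
    and b: "continuous_on S b"
    and u: "\<And>x. x \<in> S \<Longrightarrow> L x (u x) = b x"
  shows "continuous_on S u"
  unfolding continuous_on_def
proof
  fix x assume x: "x \<in> S"
  obtain c where c: "c > 0"
      "\<And>B v. norm (B - L x) < c \<Longrightarrow> c * norm v \<le> norm (blinfun_apply B v)"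
    using blinfun_inj_bounded_below[OF L(2)[OF x]] by blast
  have Lx: "(L \<longlongrightarrow> L x) (at x within S)" and bx: "(b \<longlongrightarrow> b x) (at x within S)"
    using L(1) b x by (auto simp: continuous_on_def)
  have "eventually (\<lambda>y. norm (L y - L x) < c) (at x within S)"
    using tendstoD[OF Lx c(1)] by (simp add: dist_norm)
  moreover have "eventually (\<lambda>y. y \<in> S) (at x within S)"
    by (simp add: eventually_at_topological) blast
  ultimately have "eventually (\<lambda>y. norm (u y - u x) \<le> norm (b y - L y (u x)) / c) (at x within S)"
  proof eventually_elim
    case (elim y)
    then show ?case
      using c(2)[of "L y" "u y - u x"] c(1) u[of y]
      by (simp add: blinfun.diff_right field_simps)
  qed
  moreover
  have "((\<lambda>y. norm (b y - L y (u x)) / c) \<longlongrightarrow> norm (b x - L x (u x)) / c) (at x within S)"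
    using c(1) by (intro tendsto_intros Lx bx) auto
  then have "((\<lambda>y. norm (b y - L y (u x)) / c) \<longlongrightarrow> 0) (at x within S)"
    using u[OF x] by simp
  ultimately have "((\<lambda>y. u y - u x) \<longlongrightarrow> 0) (at x within S)"
    by (rule Lim_null_comparison)
  then show "(u \<longlongrightarrow> u x) (at x within S)"
    by (rule LIM_zero_cancel)
qed

section \<open>Injectivity of immersions and the inverse map\<close>

lemma immersion_locally_injective:
  fixes f :: "'a::euclidean_space \<Rightarrow> 'b::euclidean_space"
  assumes "open U" "a \<in> U"
    and der: "\<And>x. x \<in> U \<Longrightarrow> (f has_derivative blinfun_apply (f' x)) (at x)"
    and cont: "continuous_on U f'" and inj: "inj (blinfun_apply (f' a))"
  obtains r where "r > 0" "ball a r \<subseteq> U" "inj_on f (ball a r)"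
proof -
  obtain g where g: "linear g" "g \<circ> blinfun_apply (f' a) = id"
    using linear_injective_left_inverse[OF linear_blinfun_apply inj] by blast
  have "isCont f' a"
    using assms continuous_on_eq_continuous_at by blast
  \<comment> \<open>Operator-norm continuity at \<open>a\<close>, phrased with \<open>onorm\<close>
    of plain functions as the local injectivity theorem expects it.\<close>
  then have small: "\<exists>d>0. \<forall>x. dist a x < d \<longrightarrow> onorm (\<lambda>v. f' x v - f' a v) < e" if "e > 0" for e
    using that unfolding continuous_at_eps_delta
    by (simp add: dist_norm norm_blinfun.rep_eq minus_blinfun.rep_eq norm_minus_commute)
  have "bounded_linear g"
    using g(1) by (simp add: linear_conv_bounded_linear)
  then show ?thesis
    by (rule has_derivative_locally_injective[OF \<open>a \<in> U\<close> \<open>open U\<close> _ g(2) der small])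
      (auto intro: that)
qed

text \<open>Otherwise there are pairs of distinct points with equal images, ever closer to
  \<open>K\<close>. Along a subsequence they converge to \<open>a\<close> and \<open>b\<close> in
  \<open>K\<close> with \<open>f a = f b\<close>, so \<open>a = b\<close>, and this contradicts
  injectivity of \<open>f\<close> near \<open>a\<close>.\<close>

lemma immersion_injective_near_compact:
  fixes f :: "'a::euclidean_space \<Rightarrow> 'b::euclidean_space"
  assumes "open U"
    and der: "\<And>x. x \<in> U \<Longrightarrow> (f has_derivative blinfun_apply (f' x)) (at x)"
    and cont: "continuous_on U f'" and inj: "\<And>x. x \<in> U \<Longrightarrow> inj (blinfun_apply (f' x))"
    and K: "compact K" "K \<subseteq> U" "inj_on f K"
  obtains e where "e > 0" "inj_on f (\<Union>x\<in>K. ball x e)"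
proof (rule ccontr)
  assume "\<not> thesis"
  with that have noninj: "\<not> inj_on f (\<Union>x\<in>K. ball x (inverse (real (Suc n))))" for n
    by (metis inverse_positive_iff_positive of_nat_0_less_iff zero_less_Suc)
  have "\<exists>x y p q. x \<in> K \<and> y \<in> K \<and> dist x p < inverse (real (Suc n)) \<and>
      dist y q < inverse (real (Suc n)) \<and> f p = f q \<and> p \<noteq> q" for n
    using noninj[of n] unfolding inj_on_def by (fastforce simp: mem_ball)
  then obtain x y p q where seq: "\<And>n. x n \<in> K" "\<And>n. y n \<in> K"
      "\<And>n. dist (x n) (p n) < inverse (real (Suc n))"
      "\<And>n. dist (y n) (q n) < inverse (real (Suc n))"
      "\<And>n. f (p n) = f (q n)" "\<And>n. p n \<noteq> q n"
    by metis
  \<comment> \<open>Compactness of the product yields one subsequence along which both sequences of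
    centres converge.\<close>
  have "seq_compact (K \<times> K)"
    using compact_Times[OF K(1) K(1)] by (simp add: compact_eq_seq_compact_metric)
  moreover have "\<forall>n. (x n, y n) \<in> K \<times> K"
    using seq(1,2) by simp
  ultimately obtain l r where "l \<in> K \<times> K" "strict_mono r" "((\<lambda>n. (x n, y n)) \<circ> r) \<longlonglongrightarrow> l"
    by (rule seq_compactE)
  then obtain a b where ab: "a \<in> K" "b \<in> K" "strict_mono r"
      "((\<lambda>n. (x n, y n)) \<circ> r) \<longlonglongrightarrow> (a, b)"
    by (cases l) auto
  have lims: "(\<lambda>n. x (r n)) \<longlonglongrightarrow> a" "(\<lambda>n. y (r n)) \<longlonglongrightarrow> b"
    using tendsto_fst[OF ab(4)] tendsto_snd[OF ab(4)] by (simp_all add: o_def)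
  have near: "(\<lambda>n. v (r n)) \<longlonglongrightarrow> l"
    if "(\<lambda>n. u (r n)) \<longlonglongrightarrow> l" "\<And>n. dist (u n) (v n) < inverse (real (Suc n))" for u v and l :: 'a
  proof (rule Lim_transform2[OF that(1)])
    have "(\<lambda>n. inverse (real (Suc (r n)))) \<longlonglongrightarrow> 0"
      using LIMSEQ_subseq_LIMSEQ[OF LIMSEQ_inverse_real_of_nat ab(3)] by (simp add: o_def)
    then show "(\<lambda>n. u (r n) - v (r n)) \<longlonglongrightarrow> 0"
      by (rule Lim_null_comparison[rotated])
        (use that(2) in \<open>auto simp: dist_norm intro: always_eventually less_imp_le\<close>)
  qed
  have p: "(\<lambda>n. p (r n)) \<longlonglongrightarrow> a" and q: "(\<lambda>n. q (r n)) \<longlonglongrightarrow> b"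
    using near lims seq(3,4) by blast+
  \<comment> \<open>Some \<open>p n\<close> and \<open>q n\<close> may lie outside \<open>U\<close>;
    what enters is continuity at their limits, which lie in \<open>K\<close>.\<close>
  have fcont: "isCont f z" if "z \<in> K" for z
    using der K(2) that has_derivative_continuous by blast
  have "(\<lambda>n. f (p (r n))) \<longlonglongrightarrow> f a" "(\<lambda>n. f (q (r n))) \<longlonglongrightarrow> f b"
    using isCont_tendsto_compose fcont p q ab(1,2) by blast+
  then have "f a = f b"
    using seq(5) LIMSEQ_unique by simp
  then have "a = b"
    using K(3) ab(1,2) by (simp add: inj_on_def)
  obtain s where s: "s > 0" "inj_on f (ball a s)"
    using immersion_locally_injective[OF \<open>open U\<close> _ der cont inj] K(2) ab(1) by blast
  have "eventually (\<lambda>n. dist (p (r n)) a < s) sequentially"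
    "eventually (\<lambda>n. dist (q (r n)) a < s) sequentially"
    using p q s(1) \<open>a = b\<close> tendstoD by blast+
  then have "eventually (\<lambda>n. False) sequentially"
  proof eventually_elim
    case (elim n)
    then show ?case
      using inj_onD[OF s(2) seq(5)] seq(6) by (simp add: dist_commute)
  qed
  then show False by simp
qed

text \<open>Invariance of domain makes the image open and the inverse continuous. The inverse is
  then differentiable with the inverse linear maps as derivatives.\<close>

lemma C1_diffeomorphism_onto_image:
  fixes f :: "'a::euclidean_space \<Rightarrow> 'b::euclidean_space"
  assumes "open S" and dim: "DIM('a) = DIM('b)"
    and der: "\<And>x. x \<in> S \<Longrightarrow> (f has_derivative blinfun_apply (f' x)) (at x)"
    and cont: "continuous_on S f'" and inj: "\<And>x. x \<in> S \<Longrightarrow> inj (blinfun_apply (f' x))"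
    and "inj_on f S"
  shows "C1_diffeomorphism S (f ` S) f"
proof -
  have C1: "C1_on S f"
    using der cont unfolding C1_on_def by blast
  have fc: "continuous_on S f"
    by (rule C1_on_imp_continuous_on[OF C1])
  have opn: "open (f ` S)"
    using invariance_of_domain_gen[OF \<open>open S\<close> fc \<open>inj_on f S\<close>] dim by simp
  obtain g where g: "homeomorphism S (f ` S) f g"
    using invariance_of_domain_homeomorphism[OF \<open>open S\<close> fc _ \<open>inj_on f S\<close>] dim by auto
  have gS: "g y \<in> S" "f (g y) = y" if "y \<in> f ` S" for y
    using g that by (auto simp: homeomorphism_def)
  have gc: "continuous_on (f ` S) g"
    using g by (simp add: homeomorphism_def)
  have "\<exists>h. linear h \<and> (\<forall>v. h (f' x v) = v) \<and> (\<forall>w. f' x (h w) = w)" if "x \<in> S" for x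
    using linear_injective_isomorphism[OF linear_blinfun_apply inj[OF that]] dim by simp
  then obtain h where h: "\<And>x. x \<in> S \<Longrightarrow> linear (h x)" "\<And>x v. x \<in> S \<Longrightarrow> h x (f' x v) = v"
      "\<And>x w. x \<in> S \<Longrightarrow> f' x (h x w) = w"
    by metis
  have "C1_on (f ` S) g"
  proof (rule C1_onI)
    show "(g has_derivative h (g y)) (at y)" if y: "y \<in> f ` S" for y
    proof (rule has_derivative_inverse_basic[OF der _ _ _ opn y])
      show "bounded_linear (h (g y))"
        using h(1) gS(1)[OF y] linear_conv_bounded_linear by blast
      show "h (g y) \<circ> blinfun_apply (f' (g y)) = id"
        using h(2) gS(1)[OF y] by auto
      show "isCont g y"
        using gc opn y continuous_on_eq_continuous_at by blast
    qed (use gS y in auto)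
    \<comment> \<open>For fixed \<open>w\<close>, the vector \<open>h (g y) w\<close> solves a
      linear equation with operator \<open>f' (g y)\<close> and constant right side.\<close>
    show "continuous_on (f ` S) (\<lambda>y. h (g y) w)" for w
    proof (rule continuous_on_linear_solution[where b = "\<lambda>_. w"])
      show "continuous_on (f ` S) (\<lambda>y. f' (g y))"
        using continuous_on_compose2[OF cont gc] gS by blast
    qed (use inj h gS in auto)
  qed
  with \<open>open S\<close> opn C1 g show ?thesis
    unfolding C1_diffeomorphism_def by blast
qed

section \<open>Continuous frames of the normal bundle\<close>

lemma continuous_on_adjoint:
  fixes D :: "'x::t2_space \<Rightarrow> 'a::euclidean_space \<Rightarrow>\<^sub>L 'b::euclidean_space"
  assumes "continuous_on S D" "continuous_on S b"
  shows "continuous_on S (\<lambda>x. adjoint (D x) (b x))"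
proof -
  have "adjoint (D x) (b x) = (\<Sum>i\<in>Basis. (D x i \<bullet> b x) *\<^sub>R i)" for x
  proof -
    have "adjoint (D x) (b x) = (\<Sum>i\<in>Basis. (adjoint (D x) (b x) \<bullet> i) *\<^sub>R i)"
      by (simp add: euclidean_representation)
    also have "\<dots> = (\<Sum>i\<in>Basis. (D x i \<bullet> b x) *\<^sub>R i)"
      by (simp add: inner_commute[of "adjoint (D x) (b x)"] adjoint_works[OF linear_blinfun_apply])
    finally show ?thesis .
  qed
  moreover have "continuous_on S (\<lambda>x. \<Sum>i\<in>Basis. (D x i \<bullet> b x) *\<^sub>R i)"
    by (intro continuous_intros assms)
  ultimately show ?thesis by simp
qed

text \<open>The projection is \<open>y \<mapsto> y - D (D\<^sup>T D)\<inverse> D\<^sup>T y\<close>.\<close>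

lemma continuous_normal_projection:
  fixes D :: "'x::t2_space \<Rightarrow> 'a::euclidean_space \<Rightarrow>\<^sub>L 'b::euclidean_space"
  assumes D: "continuous_on S D" and inj: "\<And>x. x \<in> S \<Longrightarrow> inj (D x)"
  obtains Q :: "'x \<Rightarrow> 'b \<Rightarrow>\<^sub>L 'b"
  where "continuous_on S Q" "\<And>x y v. x \<in> S \<Longrightarrow> Q x y \<bullet> D x v = 0"
    "\<And>x y. x \<in> S \<Longrightarrow> (\<And>v. y \<bullet> D x v = 0) \<Longrightarrow> Q x y = y"
proof -
  \<comment> \<open>The Gram operator of \<open>D x\<close>. Since \<open>G x v \<bullet> v\<close>
    is the squared norm of \<open>D x v\<close>, it inherits injectivity and is an invertible
    endomorphism.\<close>
  define G where "G x = Blinfun (\<lambda>v. adjoint (D x) (D x v))" for x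
  have lin_adj: "linear (adjoint (D x))" for x
    by (rule adjoint_linear[OF linear_blinfun_apply])
  have adj: "v \<bullet> adjoint (D x) y = D x v \<bullet> y" for x v y
    by (rule adjoint_works[OF linear_blinfun_apply])
  have G: "blinfun_apply (G x) = (\<lambda>v. adjoint (D x) (D x v))" for x
    unfolding G_def using linear_compose[OF linear_blinfun_apply lin_adj, of x "D x"]
    by (intro bounded_linear_Blinfun_apply) (simp add: linear_conv_bounded_linear o_def)
  have G_cont: "continuous_on S G"
  proof (rule continuous_on_blinfun_componentwise)
    show "continuous_on S (\<lambda>x. blinfun_apply (G x) i)" for i
      unfolding G by (intro continuous_on_adjoint continuous_intros D)
  qed
  have G_inj: "inj (blinfun_apply (G x))" if "x \<in> S" for x
  proof -
    have "v = 0" if "G x v = 0" for v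
    proof -
      have "D x v \<bullet> D x v = 0"
        using that adj[of v x "D x v"] by (simp add: G)
      then have "D x v = D x 0"
        by (simp add: blinfun.zero_right)
      then show "v = 0"
        by (rule injD[OF inj[OF \<open>x \<in> S\<close>]])
    qed
    then show ?thesis
      using linear_injective_0[OF linear_blinfun_apply] by blast
  qed
  have "\<exists>h. linear h \<and> (\<forall>w. G x (h w) = w)" if "x \<in> S" for x
    using linear_injective_isomorphism[OF linear_blinfun_apply G_inj[OF that]] by auto
  then obtain h where h: "\<And>x. x \<in> S \<Longrightarrow> linear (h x)" "\<And>x w. x \<in> S \<Longrightarrow> G x (h x w) = w"
    by metis
  define Q where "Q x = Blinfun (\<lambda>y. y - D x (h x (adjoint (D x) y)))" for x
  have Q: "blinfun_apply (Q x) = (\<lambda>y. y - D x (h x (adjoint (D x) y)))" if "x \<in> S" for x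
  proof -
    have "linear (\<lambda>y. y - D x (h x (adjoint (D x) y)))"
      using linear_compose[OF linear_compose[OF lin_adj[of x] h(1)[OF that]]
          linear_blinfun_apply[of "D x"]] linear_compose_sub[OF linear_id]
      by (simp add: o_def id_def)
    then show ?thesis
      unfolding Q_def by (intro bounded_linear_Blinfun_apply) (simp add: linear_conv_bounded_linear)
  qed
  show ?thesis
  proof (rule that)
    show "continuous_on S Q"
    proof (rule continuous_on_blinfun_componentwise)
      fix i :: 'b
      have "continuous_on S (\<lambda>x. h x (adjoint (D x) i))"
        by (rule continuous_on_linear_solution[where L = G and b = "\<lambda>x. adjoint (D x) i"])
          (auto intro: G_cont G_inj h(2) continuous_on_adjoint D)
      then have "continuous_on S (\<lambda>x. i - D x (h x (adjoint (D x) i)))"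
        by (intro continuous_intros D)
      then show "continuous_on S (\<lambda>x. blinfun_apply (Q x) i)"
        by (rule continuous_on_eq) (simp add: Q)
    qed
    show "Q x y \<bullet> D x v = 0" if "x \<in> S" for x y v
    proof -
      have "D x v \<bullet> D x (h x (adjoint (D x) y)) = D x v \<bullet> y"
        using h(2)[OF that, of "adjoint (D x) y"] adj by (metis G)
      then show ?thesis
        by (subst inner_commute) (simp add: Q[OF that] inner_diff_right)
    qed
    show "Q x y = y" if "x \<in> S" "\<And>v. y \<bullet> D x v = 0" for x y
    proof -
      \<comment> \<open>A vector normal to the range of \<open>D x\<close> is killed by the adjoint,
        so the term subtracted in \<open>Q x y\<close> vanishes.\<close>
      have "adjoint (D x) y \<bullet> adjoint (D x) y = 0"
        using adj that(2) by (metis inner_commute)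
      then show ?thesis
        using linear_0[OF h(1)[OF that(1)]] by (simp add: Q[OF that(1)] blinfun.zero_right)
    qed
  qed
qed

text \<open>The step size is half the distance of \<open>(x, 0)\<close> from the set
  \<open>B\<close> of pairs of a point and a time difference that can change \<open>R\<close> by
  \<open>e\<close> or more. Distance to a set is continuous; uniform continuity of \<open>R\<close>
  over a compact ball around \<open>x\<close> makes it positive.\<close>

lemma continuous_step_size:
  fixes R :: "real \<times> 'a::euclidean_space \<Rightarrow> 'c::metric_space"
  assumes "open S" and R: "continuous_on ({0..1} \<times> S) R" and "e > 0"
  obtains \<delta> :: "'a \<Rightarrow> real"
  where "continuous_on S \<delta>" "\<And>x. x \<in> S \<Longrightarrow> 0 < \<delta> x"
    "\<And>x s t. x \<in> S \<Longrightarrow> s \<in> {0..1} \<Longrightarrow> t \<in> {0..1} \<Longrightarrow> \<bar>s - t\<bar> \<le> \<delta> x \<Longrightarrow>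
      dist (R (s, x)) (R (t, x)) < e"
proof -
  \<comment> \<open>The point \<open>(0, 2)\<close> keeps \<open>B\<close> nonempty, since
    \<open>infdist\<close> to the empty set is 0. It has distance at least 2 from every
    \<open>(x, 0)\<close>.\<close>
  define B where "B = insert (0, 2)
    {(y, d) | y d. y \<in> S \<and> (\<exists>s\<in>{0..1}. \<exists>t\<in>{0..1}. d = s - t \<and> \<not> dist (R (s, y)) (R (t, y)) < e)}"
  have pos: "0 < infdist (x, 0) B" if "x \<in> S" for x
  proof -
    obtain r where r: "r > 0" "cball x r \<subseteq> S"
      using open_contains_cball_eq[OF \<open>open S\<close>] \<open>x \<in> S\<close> by blast
    have "uniformly_continuous_on ({0..1} \<times> cball x r) R"
      using r by (intro compact_uniformly_continuous continuous_on_subset[OF R] compact_Times) auto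
    then obtain d where d: "d > 0"
        "\<And>z z'. z \<in> {0..1} \<times> cball x r \<Longrightarrow> z' \<in> {0..1} \<times> cball x r \<Longrightarrow> dist z' z < d \<Longrightarrow>
          dist (R z') (R z) < e"
      using \<open>e > 0\<close> unfolding uniformly_continuous_on_def by metis
    \<comment> \<open>The bound 1 excludes the inserted point, \<open>r\<close> keeps the base point
      in the ball, and \<open>d\<close> comes from uniform continuity.\<close>
    have far: "min 1 (min r d) \<le> dist (x, 0) b" if b: "b \<in> B" for b
    proof (rule ccontr)
      assume close: "\<not> min 1 (min r d) \<le> dist (x, 0) b"
      have "dist x (fst b) \<le> dist (x, 0) b" "dist 0 (snd b) \<le> dist (x, 0) b"
        using dist_fst_le[of "(x, 0)" b] dist_snd_le[of "(x, 0)" b] by auto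
      then have b': "dist x (fst b) < r" "\<bar>snd b\<bar> < d" "\<bar>snd b\<bar> < 1"
        using close by (auto simp: dist_real_def)
      then obtain s t where st: "s \<in> {0..1}" "t \<in> {0..1}" "snd b = s - t"
          "\<not> dist (R (s, fst b)) (R (t, fst b)) < e"
        using b unfolding B_def by auto
      have "dist (s, fst b) (t, fst b) < d"
        using st(3) b'(2) by (simp add: dist_Pair_Pair dist_real_def)
      then show False
        using d(2)[of "(t, fst b)" "(s, fst b)"] st b'(1) by auto
    qed
    have "B \<noteq> {}"
      by (simp add: B_def)
    then have "min 1 (min r d) \<le> infdist (x, 0) B"
      using far by (auto simp: infdist_notempty intro: cINF_greatest)
    then show ?thesis
      using r(1) d(1) by linarith
  qed
  \<comment> \<open>Halving makes the contradiction strict: a bad time difference is at least the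
    full distance.\<close>
  show ?thesis
  proof (rule that[of "\<lambda>x. infdist (x, 0) B / 2"])
    show "continuous_on S (\<lambda>x. infdist (x, 0) B / 2)"
      by (intro continuous_intros) auto
    show "0 < infdist (x, 0) B / 2" if "x \<in> S" for x
      using pos[OF that] by simp
    show "dist (R (s, x)) (R (t, x)) < e"
      if "x \<in> S" "s \<in> {0..1}" "t \<in> {0..1}" "\<bar>s - t\<bar> \<le> infdist (x, 0) B / 2" for x s t
    proof (rule ccontr)
      assume "\<not> dist (R (s, x)) (R (t, x)) < e"
      then have "(x, s - t) \<in> B"
        using that unfolding B_def by blast
      then have "infdist (x, 0) B \<le> \<bar>s - t\<bar>"
        using infdist_le[of "(x, s - t)" B "(x, 0)"] by (simp add: dist_Pair_Pair dist_real_def)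
      then show False
        using pos[OF that(1)] that(4) by linarith
    qed
  qed
qed

text \<open>The orthogonal complement of \<open>range A\<close> has the dimension of
  \<open>'k\<close>, so \<open>'k\<close> maps isometrically onto it.\<close>

lemma ex_normal_frame:
  fixes A :: "'v::euclidean_space \<Rightarrow>\<^sub>L 'b::euclidean_space"
  assumes "inj A" and dim: "DIM('k::euclidean_space) + DIM('v) = DIM('b)"
  obtains F :: "'k::euclidean_space \<Rightarrow>\<^sub>L 'b" where "inj F" "\<And>w v. F w \<bullet> A v = 0"
proof -
  define W where "W = {y \<in> UNIV. \<forall>x \<in> range A. orthogonal x y}"
  have "dim W + dim (range A) = dim (UNIV :: 'b set)"
    unfolding W_def
    by (intro dim_subspace_orthogonal_to_vectors linear_subspace_image linear_blinfun_apply) auto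
  moreover have "dim (range A) = DIM('v)"
    using dim_image_eq[OF linear_blinfun_apply, of A UNIV] \<open>inj A\<close> by simp
  ultimately have "dim (UNIV :: 'k set) = dim W"
    using dim by simp
  moreover have "subspace W"
    unfolding W_def subspace_def by (auto simp: orthogonal_def inner_simps)
  ultimately obtain f g where f: "linear f" "f ` (UNIV :: 'k set) = W"
      "\<And>x. x \<in> (UNIV :: 'k set) \<Longrightarrow> norm (f x) = norm x"
    using isometries_subspaces[of "UNIV :: 'k set" W] by (metis subspace_UNIV)
  have app: "blinfun_apply (Blinfun f) = f"
    using f(1) by (simp add: bounded_linear_Blinfun_apply linear_conv_bounded_linear)
  have "w = 0" if "f w = 0" for w
    using f(3)[of w] that by simp
  then have "inj f"
    using linear_injective_0[OF f(1)] by blast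
  moreover have "f w \<bullet> A v = 0" for w v
  proof -
    have "f w \<in> W"
      using f(2) by blast
    then show ?thesis
      by (simp add: W_def orthogonal_def inner_commute)
  qed
  ultimately show ?thesis
    using that[of "Blinfun f"] app by simp
qed

text \<open>
  Pull the normal bundle back along a contraction \<open>h\<close> and carry a frame over the point \<open>h (1, x)\<close> back
  to \<open>x\<close> by successive orthogonal projections, in time steps \<open>\<delta> x\<close> so small that the projections stay
  injective. Steps after reaching time 0 change nothing, so their number need only be locally bounded.
\<close>

lemma contractible_normal_frame:
  fixes D :: "'a::euclidean_space \<Rightarrow> 'v::euclidean_space \<Rightarrow>\<^sub>L 'b::euclidean_space"
  assumes "open S" "contractible S" and D: "continuous_on S D" "\<And>x. x \<in> S \<Longrightarrow> inj (D x)"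
    and dim: "DIM('k::euclidean_space) + DIM('v) = DIM('b)"
  obtains F :: "'a \<Rightarrow> 'k::euclidean_space \<Rightarrow>\<^sub>L 'b"
  where "continuous_on S F" "\<And>x. x \<in> S \<Longrightarrow> inj (F x)"
    "\<And>x w v. x \<in> S \<Longrightarrow> F x w \<bullet> D x v = 0"
proof (cases "S = {}")
  case True
  then show ?thesis using that[of "\<lambda>_. 0"] by simp
next
  case False
  obtain h c where h: "continuous_on ({0..1} \<times> S) h" "h \<in> {0..1::real} \<times> S \<rightarrow> S"
      "\<And>x. x \<in> S \<Longrightarrow> h (0, x) = x" "\<And>x. x \<in> S \<Longrightarrow> h (1, x) = c"
    using \<open>contractible S\<close> unfolding contractible_def homotopic_with
    by (auto simp: homotopic_with[where P = "\<lambda>_. True", simplified])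
  have hS: "h (t, x) \<in> S" if "t \<in> {0..1}" "x \<in> S" for t x
    using h(2) that by blast
  have "c \<in> S"
    using False h(4) hS[of 1] by (metis atLeastAtMost_iff equals0I order_refl zero_le_one)
  obtain Q :: "'a \<Rightarrow> 'b \<Rightarrow>\<^sub>L 'b" where Q: "continuous_on S Q"
      "\<And>x y v. x \<in> S \<Longrightarrow> Q x y \<bullet> D x v = 0"
      "\<And>x y. x \<in> S \<Longrightarrow> (\<And>v. y \<bullet> D x v = 0) \<Longrightarrow> Q x y = y"
    using continuous_normal_projection[OF D] by blast
  define R where "R z = Q (h z)" for z
  have R: "continuous_on ({0..1} \<times> S) R"
    unfolding R_def using h(2) by (intro continuous_on_compose2[OF Q(1) h(1)]) blast
  obtain \<delta> where \<delta>: "continuous_on S \<delta>" "\<And>x. x \<in> S \<Longrightarrow> 0 < \<delta> x"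
      "\<And>x s t. x \<in> S \<Longrightarrow> s \<in> {0..1} \<Longrightarrow> t \<in> {0..1} \<Longrightarrow> \<bar>s - t\<bar> \<le> \<delta> x \<Longrightarrow>
        dist (R (s, x)) (R (t, x)) < 1"
    using continuous_step_size[OF \<open>open S\<close> R zero_less_one] by blast
  obtain F0 :: "'k \<Rightarrow>\<^sub>L 'b" where F0: "inj F0" "\<And>w v. F0 w \<bullet> D c v = 0"
    using ex_normal_frame[OF D(2)[OF \<open>c \<in> S\<close>] dim] by blast
  \<comment> \<open>Times descend from 1 in steps of \<open>\<delta> x\<close> and stop at 0. Below,
    \<open>A i x\<close> is a frame of the normal space at \<open>h (t i x, x)\<close>, starting
    from \<open>F0\<close> over \<open>c\<close>.\<close>
  define t where "t i x = max 0 (1 - real i * \<delta> x)" for i x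
  define A where "A i x = rec_nat F0 (\<lambda>i a. R (t (Suc i) x, x) o\<^sub>L a) i" for i x
  have A_0: "A 0 x = F0" and A_Suc: "A (Suc i) x = R (t (Suc i) x, x) o\<^sub>L A i x" for i x
    by (simp_all add: A_def)
  have t01: "t i x \<in> {0..1}" if "x \<in> S" for i x
    using \<delta>(2)[OF that] by (simp add: t_def)
  have A_cont: "continuous_on S (A i)" for i
  proof (induction i)
    case 0
    then show ?case by (simp add: A_0[abs_def])
  next
    case (Suc i)
    have "continuous_on S (\<lambda>x. (t (Suc i) x, x))"
      unfolding t_def by (intro continuous_intros \<delta>(1))
    then have "continuous_on S (\<lambda>x. R (t (Suc i) x, x))"
      using t01 by (intro continuous_on_compose2[OF R]) auto
    then show ?case
      unfolding A_Suc[abs_def] by (intro continuous_intros Suc.IH)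
  qed
  have A: "inj (A i x) \<and> (\<forall>w v. A i x w \<bullet> D (h (t i x, x)) v = 0)" if x: "x \<in> S" for i x
  proof (induction i)
    case 0
    then show ?case using F0 h(4)[OF x] by (simp add: A_0 t_def)
  next
    case (Suc i)
    have "w = 0" if w: "A (Suc i) x w = 0" for w
    proof (rule ccontr)
      assume "w \<noteq> 0"
      define z where "z = A i x w"
      have "z \<noteq> 0"
        using \<open>w \<noteq> 0\<close> Suc.IH linear_injective_0[OF linear_blinfun_apply, of "A i x"]
        by (auto simp: z_def)
      have "R (t i x, x) z = z"
        using Q(3)[OF hS[OF t01[OF x] x]] Suc.IH unfolding z_def R_def by blast
      moreover have "R (t (Suc i) x, x) z = 0"
        using w by (simp add: A_Suc z_def)
      \<comment> \<open>The old projection fixes \<open>z\<close> and the new one kills it, so their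
        difference maps \<open>z\<close> to itself, although its norm is below 1.\<close>
      ultimately have "norm z \<le> norm (R (t i x, x) - R (t (Suc i) x, x)) * norm z"
        using norm_blinfun[of "R (t i x, x) - R (t (Suc i) x, x)" z]
        by (simp add: blinfun.diff_left)
      moreover have "\<bar>t i x - t (Suc i) x\<bar> \<le> \<delta> x"
        using \<delta>(2)[OF x] by (simp add: t_def max_def algebra_simps)
      then have "norm (R (t i x, x) - R (t (Suc i) x, x)) < 1"
        using \<delta>(3)[OF x t01[OF x] t01[OF x]] by (simp add: dist_norm)
      ultimately show False
        using \<open>z \<noteq> 0\<close> by (metis mult_less_cancel_right2 not_less zero_less_norm_iff)
    qed
    then have "inj (A (Suc i) x)"
      using linear_injective_0[OF linear_blinfun_apply] by blast
    moreover have "A (Suc i) x w \<bullet> D (h (t (Suc i) x, x)) v = 0" for w v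
      using Q(2)[OF hS[OF t01[OF x] x]] by (simp add: A_Suc R_def)
    ultimately show ?case by blast
  qed
  have t_0: "t i x = 0" if "1 \<le> real i * \<delta> x" for i x
    using that by (simp add: t_def)
  have A_stable: "A j x = A i x" if x: "x \<in> S" and i: "1 \<le> real i * \<delta> x" and "i \<le> j" for x i j
    using \<open>i \<le> j\<close>
  proof (induction j rule: dec_induct)
    case (step j)
    have "real i * \<delta> x \<le> real j * \<delta> x" "real i * \<delta> x \<le> real (Suc j) * \<delta> x"
      using step.hyps(1) \<delta>(2)[OF x] by (intro mult_right_mono; simp)+
    then have "t j x = 0" "t (Suc j) x = 0"
      using i by (auto intro!: t_0)
    \<comment> \<open>At time 0 the projection is \<open>Q x\<close>, which fixes the vectors of a
      frame already normal at \<open>x\<close>.\<close>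
    then have "A (Suc j) x w = A j x w" for w
      using A[OF x, of j] Q(3)[OF x, of "A j x w"] h(3)[OF x] by (simp add: A_Suc R_def)
    then show ?case
      using step.IH by (simp add: blinfun_eqI)
  qed simp
  \<comment> \<open>After this many steps time 0 is reached. The count may jump with
    \<open>x\<close>, so continuity needs a locally constant count.\<close>
  define F where "F x = A (nat \<lceil>1 / \<delta> x\<rceil>) x" for x
  have steps: "1 \<le> real (nat \<lceil>1 / d\<rceil>) * d'" if "0 < d" "d \<le> d'" for d d' :: real
  proof -
    have "1 / d \<le> real (nat \<lceil>1 / d\<rceil>)"
      by (rule real_nat_ceiling_ge)
    then have "1 \<le> real (nat \<lceil>1 / d\<rceil>) * d"
      using that(1) by (simp only: pos_divide_le_eq)
    also have "\<dots> \<le> real (nat \<lceil>1 / d\<rceil>) * d'"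
      using that(2) by (intro mult_left_mono of_nat_0_le_iff)
    finally show ?thesis .
  qed
  show ?thesis
  proof (rule that)
    show "continuous_on S F"
      unfolding continuous_on_def
    proof
      fix x assume x: "x \<in> S"
      \<comment> \<open>This count suffices for every \<open>y\<close> with
        \<open>\<delta> y\<close> above \<open>\<delta> x / 2\<close>, so by stability
        \<open>F\<close> agrees near \<open>x\<close> with the single continuous map
        \<open>A ?n\<close>.\<close>
      let ?n = "nat \<lceil>1 / (\<delta> x / 2)\<rceil>"
      have F_eq: "F y = A ?n y" if y: "y \<in> S" "\<delta> x / 2 < \<delta> y" for y
      proof -
        let ?m = "nat \<lceil>1 / \<delta> y\<rceil>"
        have "A (max ?m ?n) y = A ?m y" "A (max ?m ?n) y = A ?n y"
          using steps[of "\<delta> y" "\<delta> y"] steps[of "\<delta> x / 2" "\<delta> y"] \<delta>(2)[OF x] y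
          by (intro A_stable; simp)+
        then show ?thesis by (simp add: F_def)
      qed
      have "(\<delta> \<longlongrightarrow> \<delta> x) (at x within S)"
        using \<delta>(1) x by (simp add: continuous_on_def)
      then have "eventually (\<lambda>y. \<delta> x / 2 < \<delta> y) (at x within S)"
        using \<delta>(2)[OF x] by (intro order_tendstoD) auto
      moreover have "eventually (\<lambda>y. y \<in> S) (at x within S)"
        by (simp add: eventually_at_topological) blast
      ultimately have ev: "eventually (\<lambda>y. A ?n y = F y) (at x within S)"
        by eventually_elim (simp add: F_eq)
      have "(A ?n \<longlongrightarrow> A ?n x) (at x within S)"
        using A_cont x by (simp add: continuous_on_def)
      then show "(F \<longlongrightarrow> F x) (at x within S)"
        using F_eq[OF x] \<delta>(2)[OF x] Lim_transform_eventually[OF _ ev] by simp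
    qed
    show "inj (F x)" if "x \<in> S" for x
      using A[OF that] by (simp add: F_def)
    show "F x w \<bullet> D x v = 0" if "x \<in> S" for x w v
      using A[OF that, of "nat \<lceil>1 / \<delta> x\<rceil>"] t_0[OF steps[OF \<delta>(2)[OF that] order_refl]] h(3)[OF that]
      by (simp add: F_def)
  qed
qed

section \<open>The extension theorem\<close>

text \<open>The norm of the matrix type is the Euclidean norm of the row norms; Cauchy-Schwarz
  applies row by row.\<close>

lemma norm_matrix_vector_mult_le:
  fixes M :: "real ^ 'k ^ 'm"
  shows "norm (M *v w) \<le> norm M * norm w"
proof -
  have "norm (M *v w) \<le> L2_set (\<lambda>i. norm (M $ i) * norm w) UNIV"
    unfolding norm_vec_def[of "M *v w"]
    by (rule L2_set_mono) (auto simp: matrix_vector_mul_component Cauchy_Schwarz_ineq2)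
  also have "\<dots> = norm M * norm w"
    by (simp add: norm_vec_def[of M] L2_set_left_distrib)
  finally show ?thesis .
qed

lemma bounded_bilinear_matrix_vector_mult:
  "bounded_bilinear (\<lambda>(M :: real ^ 'k ^ 'm) w. M *v w)"
  by (intro bounded_bilinear.intro exI[of _ 1])
    (auto simp: matrix_vector_mult_add_rdistrib matrix_vector_right_distrib
      scaleR_matrix_vector_assoc matrix_vector_mult_scaleR norm_matrix_vector_mult_le)

lemma open_inj_blinfun:
  "open {A :: 'a::euclidean_space \<Rightarrow>\<^sub>L 'b::euclidean_space. inj (blinfun_apply A)}"
  unfolding open_dist
proof
  fix A :: "'a \<Rightarrow>\<^sub>L 'b"
  assume "A \<in> {A. inj (blinfun_apply A)}"
  then obtain c where "c > 0" "\<And>B. norm (B - A) < c \<Longrightarrow> inj (blinfun_apply B)"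
    using blinfun_inj_near[of A] by blast
  then show "\<exists>e>0. \<forall>B. dist B A < e \<longrightarrow> B \<in> {A. inj (blinfun_apply A)}"
    by (auto simp: dist_norm)
qed

text \<open>
  Any \<open>\<gamma> x\<close> with \<open>F x w \<bullet> (\<gamma> x *v w) > 0\<close> for \<open>w \<noteq> 0\<close> is still complementary to the tangent space, and
  for fixed \<open>x\<close> this condition is convex.
\<close>

lemma C1_complement:
  fixes D :: "'a::euclidean_space \<Rightarrow> 'v::euclidean_space \<Rightarrow>\<^sub>L (real ^ 'm)"
  assumes "open S" "contractible S" and D: "continuous_on S D" "\<And>x. x \<in> S \<Longrightarrow> inj (D x)"
    and dim: "CARD('k::finite) + DIM('v) = CARD('m)"
  obtains \<gamma> :: "'a \<Rightarrow> real ^ 'k ^ 'm"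
  where "C1_on S \<gamma>" "\<And>x v w. x \<in> S \<Longrightarrow> D x v + \<gamma> x *v w = 0 \<Longrightarrow> v = 0 \<and> w = 0"
proof -
  obtain F :: "'a \<Rightarrow> (real ^ 'k) \<Rightarrow>\<^sub>L (real ^ 'm)" where F: "continuous_on S F"
      "\<And>x. x \<in> S \<Longrightarrow> inj (F x)" "\<And>x w v. x \<in> S \<Longrightarrow> F x w \<bullet> D x v = 0"
    using contractible_normal_frame[OF assms(1,2) D, where 'k = "real ^ 'k"] dim by auto
  define M where "M x = matrix (blinfun_apply (F x))" for x
  have M: "M x *v w = F x w" for x w
    unfolding M_def by (simp add: matrix_vector_mul(2)[OF linear_blinfun_apply])
  have M_cont: "continuous_on S M"
    unfolding M_def matrix_def by (intro continuous_intros F(1))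
  define G where "G x = {A :: real ^ 'k ^ 'm. \<forall>w. w \<noteq> 0 \<longrightarrow> 0 < F x w \<bullet> (A *v w)}" for x
  have "\<exists>\<gamma>. C1_on S \<gamma> \<and> (\<forall>x\<in>S. \<gamma> x \<in> G x)"
  proof (rule C1_selection[OF \<open>open S\<close> M_cont])
    show "convex (G x)" for x
    proof (rule convexI)
      fix A B and u v :: real
      assume AB: "A \<in> G x" "B \<in> G x" and uv: "0 \<le> u" "0 \<le> v" "u + v = 1"
      have "0 < u * (F x w \<bullet> (A *v w)) + v * (F x w \<bullet> (B *v w))" if "w \<noteq> 0" for w
      proof -
        have "0 < F x w \<bullet> (A *v w)" "0 < F x w \<bullet> (B *v w)"
          using AB that by (auto simp: G_def)
        then show ?thesis
          using uv by (cases "u = 0") (auto intro!: add_pos_nonneg)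
      qed
      then show "u *\<^sub>R A + v *\<^sub>R B \<in> G x"
        by (simp add: G_def matrix_vector_mult_add_rdistrib inner_add_right
            flip: scaleR_matrix_vector_assoc)
    qed
    show "\<exists>e>0. \<forall>x\<in>K. ball (M x) e \<subseteq> G x" if K: "compact K" "K \<subseteq> S" for K
    proof (cases "K = {}")
      case True
      then show ?thesis by (auto intro: exI[of _ 1])
    next
      case False
      let ?C = "K \<times> sphere (0 :: real ^ 'k) 1"
      have "continuous_on ?C (\<lambda>z. norm (F (fst z) (snd z)))"
        using K(2) by (intro continuous_intros continuous_on_compose2[OF F(1)]) auto
      moreover have "compact ?C" "?C \<noteq> {}"
        using K(1) False by (auto simp: compact_Times)
      ultimately obtain x0 w0 where 0: "x0 \<in> K" "norm w0 = 1"
          "\<And>x w. x \<in> K \<Longrightarrow> norm w = 1 \<Longrightarrow> norm (F x0 w0) \<le> norm (F x w)"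
        using continuous_attains_inf[of ?C "\<lambda>z. norm (F (fst z) (snd z))"] by fastforce
      \<comment> \<open>The minimum of \<open>norm (F x w)\<close> over \<open>K\<close> and the
        unit sphere. A matrix within \<open>c\<close> of \<open>M x\<close> changes
        \<open>F x w\<close> by less than its own norm, so the inner product stays positive.\<close>
      define c where "c = norm (F x0 w0)"
      have ker: "w = 0" if "x \<in> S" "F x w = 0" for x w
        using that F(2) linear_injective_0[OF linear_blinfun_apply] by blast
      have "c > 0"
        using 0(1,2) K(2) ker[of x0 w0] unfolding c_def by auto
      have below: "c * norm w \<le> norm (F x w)" if "x \<in> K" "w \<noteq> 0" for x w
        using 0(3)[OF that(1), of "w /\<^sub>R norm w"] that(2)
        by (simp add: c_def blinfun.scaleR_right field_simps)
      have "A \<in> G x" if x: "x \<in> K" and A: "A \<in> ball (M x) c" for x A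
        unfolding G_def
      proof (intro CollectI allI impI)
        fix w :: "real ^ 'k" assume w: "w \<noteq> 0"
        have "norm ((A - M x) *v w) \<le> norm (A - M x) * norm w"
          by (rule norm_matrix_vector_mult_le)
        also have "\<dots> < c * norm w"
          using A w by (simp add: dist_norm norm_minus_commute)
        also have "\<dots> \<le> norm (F x w)"
          by (rule below[OF x w])
        finally have less: "norm ((A - M x) *v w) < norm (F x w)" .
        then have "norm (F x w) * norm ((A - M x) *v w) < norm (F x w) * norm (F x w)"
          by (intro mult_strict_left_mono) auto
        moreover have "\<bar>F x w \<bullet> ((A - M x) *v w)\<bar> \<le> norm (F x w) * norm ((A - M x) *v w)"
          by (rule Cauchy_Schwarz_ineq2)
        ultimately have "0 < F x w \<bullet> F x w + F x w \<bullet> ((A - M x) *v w)"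
          by (simp add: dot_square_norm power2_eq_square)
        then show "0 < F x w \<bullet> (A *v w)"
          by (simp add: matrix_vector_mult_diff_rdistrib inner_diff_right M)
      qed
      with \<open>c > 0\<close> show ?thesis by blast
    qed
  qed
  then obtain \<gamma> where \<gamma>: "C1_on S \<gamma>" "\<And>x. x \<in> S \<Longrightarrow> \<gamma> x \<in> G x"
    by blast
  show ?thesis
  proof (rule that[OF \<gamma>(1)])
    fix x v w assume x: "x \<in> S" and eq: "D x v + \<gamma> x *v w = 0"
    \<comment> \<open>Pairing with the normal vector \<open>F x w\<close> removes the tangential
      term; for nonzero \<open>w\<close> the left side would be positive.\<close>
    have "F x w \<bullet> (\<gamma> x *v w) = F x w \<bullet> (D x v + \<gamma> x *v w)"
      by (simp add: inner_add_right F(3)[OF x])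
    then have "w = 0"
      using \<gamma>(2)[OF x] eq unfolding G_def by force
    moreover from this have "D x v = D x 0"
      using eq by (simp add: blinfun.zero_right)
    then have "v = 0"
      by (rule injD[OF D(2)[OF x]])
    ultimately show "v = 0 \<and> w = 0" by simp
  qed
qed

text \<open>On the zero section the derivative is \<open>D x v + \<gamma> x *v w\<close>, which is
  injective by \<open>compl\<close>, and the map itself is \<open>\<tau>\<close>. Injectivity of
  both the derivative and the map therefore persists near the compact set
  \<open>closure T \<times> {0}\<close>.\<close>

lemma tubular_diffeomorphism:
  fixes \<tau> :: "'a::euclidean_space \<Rightarrow> real ^ 'm" and \<gamma> :: "'a \<Rightarrow> real ^ 'k ^ 'm"
  assumes "open S" and \<tau>: "C1_on S \<tau>" "inj_on \<tau> S" and \<gamma>: "C1_on S \<gamma>"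
    and D: "\<And>x. x \<in> S \<Longrightarrow> (\<tau> has_derivative D x) (at x)"
    and compl: "\<And>x v w. x \<in> S \<Longrightarrow> D x v + \<gamma> x *v w = 0 \<Longrightarrow> v = 0 \<and> w = 0"
    and dim: "DIM('a) + CARD('k) = CARD('m)"
    and T: "open T" "bounded T" "closure T \<subseteq> S"
  obtains \<epsilon> where "\<epsilon> > 0"
    "C1_diffeomorphism (T \<times> ball 0 \<epsilon>) ((\<lambda>(x, w). \<tau> x + \<gamma> x *v w) ` (T \<times> ball 0 \<epsilon>))
      (\<lambda>(x, w). \<tau> x + \<gamma> x *v w)"
proof -
  define \<Phi> where "\<Phi> = (\<lambda>(x, w). \<tau> x + \<gamma> x *v w)"
  have \<Phi>_fst_snd: "\<Phi> = (\<lambda>p. \<tau> (fst p) + \<gamma> (fst p) *v snd p)"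
    by (auto simp: \<Phi>_def)
  let ?U = "S \<times> (UNIV :: (real ^ 'k) set)"
  have "C1_on ?U \<Phi>"
    unfolding \<Phi>_fst_snd
    by (intro C1_on_add C1_on_bilinear[OF bounded_bilinear_matrix_vector_mult]
        C1_on_compose[OF C1_on_bounded_linear[OF bounded_linear_fst] \<tau>(1)]
        C1_on_compose[OF C1_on_bounded_linear[OF bounded_linear_fst] \<gamma>]
        C1_on_bounded_linear bounded_linear_snd) auto
  then obtain \<Phi>' where \<Phi>': "\<And>p. p \<in> ?U \<Longrightarrow> (\<Phi> has_derivative blinfun_apply (\<Phi>' p)) (at p)"
      "continuous_on ?U \<Phi>'"
    unfolding C1_on_def by blast
  have inj0: "inj (blinfun_apply (\<Phi>' (x, 0)))" if x: "x \<in> S" for x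
  proof -
    obtain \<gamma>' where \<gamma>': "(\<gamma> has_derivative \<gamma>') (at x)"
      using \<gamma> x unfolding C1_on_def by blast
    \<comment> \<open>The product rule contributes \<open>\<gamma>'\<close> applied to the second
      coordinate, which is 0 here.\<close>
    have "(\<Phi> has_derivative (\<lambda>p. D x (fst p) + (\<gamma> x *v snd p + \<gamma>' (fst p) *v 0))) (at (x, 0))"
      unfolding \<Phi>_fst_snd
      using bounded_bilinear.FDERIV[OF bounded_bilinear_matrix_vector_mult
          has_derivative_compose[where f = fst and x = "(x, 0)" and s = UNIV and g = \<gamma>,
            OF bounded_linear_imp_has_derivative[OF bounded_linear_fst]]
          bounded_linear_imp_has_derivative[OF bounded_linear_snd]] \<gamma>'
        has_derivative_compose[where f = fst and x = "(x, 0)" and s = UNIV and g = \<tau>,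
            OF bounded_linear_imp_has_derivative[OF bounded_linear_fst]] D[OF x]
      by (intro has_derivative_add) auto
    then have "blinfun_apply (\<Phi>' (x, 0)) = (\<lambda>p. D x (fst p) + (\<gamma> x *v snd p + \<gamma>' (fst p) *v 0))"
      using \<Phi>'(1)[of "(x, 0)"] x by (intro has_derivative_unique) auto
    then have "p = 0" if "\<Phi>' (x, 0) p = 0" for p
      using compl[OF x, of "fst p" "snd p"] that by (simp add: prod_eq_iff)
    then show ?thesis
      using linear_injective_0[OF linear_blinfun_apply] by blast
  qed
  define V where "V = ?U \<inter> \<Phi>' -` {A. inj (blinfun_apply A)}"
  have "open V"
    unfolding V_def
    by (rule continuous_open_preimage[OF \<Phi>'(2) _ open_inj_blinfun])
      (simp add: \<open>open S\<close> open_Times)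
  have V: "(\<Phi> has_derivative blinfun_apply (\<Phi>' p)) (at p)" "inj (blinfun_apply (\<Phi>' p))"
    if "p \<in> V" for p
    using that \<Phi>'(1) by (auto simp: V_def)
  have \<Phi>'_V: "continuous_on V \<Phi>'"
    using \<Phi>'(2) by (rule continuous_on_subset) (simp add: V_def)
  define K where "K = closure T \<times> {0 :: real ^ 'k}"
  have K: "compact K" "K \<subseteq> V"
    using T(2,3) inj0 by (auto simp: K_def V_def compact_Times)
  have "inj_on \<Phi> K"
    using \<tau>(2) T(3) by (auto simp: K_def \<Phi>_def inj_on_def)
  then obtain e where e: "e > 0" "inj_on \<Phi> (\<Union>p\<in>K. ball p e)"
    using immersion_injective_near_compact[OF \<open>open V\<close> V(1) \<Phi>'_V V(2) K] by blast
  obtain d where d: "d > 0" "(\<Union>p\<in>K. ball p d) \<subseteq> V"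
    using compact_subset_open_imp_ball_epsilon_subset[OF K(1) \<open>open V\<close> K(2)] by blast
  \<comment> \<open>Within \<open>e\<close> of \<open>K\<close> the map is injective, within
    \<open>d\<close> its derivative is. A point \<open>(x, w)\<close> has distance
    \<open>norm w\<close> from \<open>(x, 0)\<close>.\<close>
  define \<epsilon> where "\<epsilon> = min e d"
  have sub: "T \<times> ball 0 \<epsilon> \<subseteq> (\<Union>p\<in>K. ball p e) \<inter> (\<Union>p\<in>K. ball p d)"
  proof
    fix p assume p: "p \<in> T \<times> ball (0 :: real ^ 'k) \<epsilon>"
    then have "(fst p, 0) \<in> K" "dist (fst p, 0) p < \<epsilon>"
      using subsetD[OF closure_subset[of T]] by (auto simp: K_def dist_Pair_Pair)
    then show "p \<in> (\<Union>p\<in>K. ball p e) \<inter> (\<Union>p\<in>K. ball p d)"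
      by (fastforce simp: \<epsilon>_def)
  qed
  have sub_V: "T \<times> ball 0 \<epsilon> \<subseteq> V"
    using sub d(2) by blast
  have "C1_diffeomorphism (T \<times> ball 0 \<epsilon>) (\<Phi> ` (T \<times> ball 0 \<epsilon>)) \<Phi>"
  proof (rule C1_diffeomorphism_onto_image)
    show "continuous_on (T \<times> ball 0 \<epsilon>) \<Phi>'"
      using \<Phi>'_V sub_V by (rule continuous_on_subset)
    show "inj_on \<Phi> (T \<times> ball 0 \<epsilon>)"
      using e(2) by (rule inj_on_subset) (use sub in blast)
    show "open (T \<times> ball (0 :: real ^ 'k) \<epsilon>)"
      using T(1) by (simp add: open_Times)
    show "DIM('a \<times> (real ^ 'k)) = DIM(real ^ 'm)"
      using dim by simp
  qed (use V sub_V in blast)+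
  then show ?thesis
    using that[of \<epsilon>] e(1) d(1) by (simp add: \<epsilon>_def \<Phi>_def)
qed

theorem corollary2p6:
  fixes \<A> \<O> :: "(real ^ 'n) set"
    and \<tau> :: "real ^ 'n \<Rightarrow> real ^ 'm"
  assumes "CARD('m) > CARD('n)"
    and "CARD('k::finite) = CARD('m) - CARD('n)"
    and "bounded \<A>"
    and "open \<O>" and "closure \<A> \<subseteq> \<O>" and "contractible \<O>"
    and "C1_immersion_on \<O> \<tau>" and "inj_on \<tau> \<O>"
  shows "\<exists>\<gamma> :: real ^ 'n \<Rightarrow> real ^ 'k ^ 'm. C1_on \<O> \<gamma> \<and>
    (\<forall>\<O>\<^sub>t. open \<O>\<^sub>t \<and> bounded \<O>\<^sub>t \<and> closure \<A> \<subseteq> \<O>\<^sub>t \<and> \<O>\<^sub>t \<subseteq> closure \<O>\<^sub>t \<and> closure \<O>\<^sub>t \<subseteq> \<O> \<longrightarrow>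
      (\<exists>\<epsilon>>0.
        let \<tau>\<^sub>a = (\<lambda>(x :: real ^ 'n, w :: real ^ 'k). \<tau> x + \<gamma> x *v w);
            \<O>\<^sub>a = \<O>\<^sub>t \<times> ball (0 :: real ^ 'k) \<epsilon>
        in open \<O>\<^sub>a \<and> closure (\<A> \<times> {0}) \<subseteq> \<O>\<^sub>a \<and>
           C1_diffeomorphism \<O>\<^sub>a (\<tau>\<^sub>a ` \<O>\<^sub>a) \<tau>\<^sub>a \<and>
           (\<forall>x\<in>\<A>. \<tau>\<^sub>a (x, 0) = \<tau> x)))"
proof -
  have C1: "C1_on \<O> \<tau>" and imm: "\<And>x. x \<in> \<O> \<Longrightarrow> inj (frechet_derivative \<tau> (at x))"
    using \<open>C1_immersion_on \<O> \<tau>\<close> by (auto simp: C1_immersion_on_def)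
  obtain D where D: "\<And>x. x \<in> \<O> \<Longrightarrow> (\<tau> has_derivative blinfun_apply (D x)) (at x)"
      "continuous_on \<O> D"
    using C1 unfolding C1_on_def by blast
  have D_inj: "inj (blinfun_apply (D x))" if "x \<in> \<O>" for x
    using imm[OF that] frechet_derivative_at[OF D(1)[OF that]] by simp
  have dim: "CARD('k) + DIM(real ^ 'n) = CARD('m)"
    using assms(1,2) by simp
  \<comment> \<open>The choice of \<open>\<gamma>\<close> precedes that of
    \<open>\<O>\<^sub>t\<close>; only \<open>\<epsilon>\<close> depends on the latter.\<close>
  obtain \<gamma> :: "real ^ 'n \<Rightarrow> real ^ 'k ^ 'm" where \<gamma>: "C1_on \<O> \<gamma>"
      "\<And>x v w. x \<in> \<O> \<Longrightarrow> D x v + \<gamma> x *v w = 0 \<Longrightarrow> v = 0 \<and> w = 0"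
    using C1_complement[OF \<open>open \<O>\<close> \<open>contractible \<O>\<close> D(2) D_inj dim] by blast
  have "\<exists>\<epsilon>>0. open (T \<times> ball (0 :: real ^ 'k) \<epsilon>) \<and>
      closure (\<A> \<times> {0}) \<subseteq> T \<times> ball (0 :: real ^ 'k) \<epsilon> \<and>
      C1_diffeomorphism (T \<times> ball 0 \<epsilon>) ((\<lambda>(x, w). \<tau> x + \<gamma> x *v w) ` (T \<times> ball 0 \<epsilon>))
        (\<lambda>(x, w). \<tau> x + \<gamma> x *v w)"
    if T: "open T" "bounded T" "closure \<A> \<subseteq> T" "closure T \<subseteq> \<O>" for T
  proof -
    obtain \<epsilon> where "\<epsilon> > 0"
      "C1_diffeomorphism (T \<times> ball 0 \<epsilon>) ((\<lambda>(x, w). \<tau> x + \<gamma> x *v w) ` (T \<times> ball 0 \<epsilon>))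
        (\<lambda>(x, w). \<tau> x + \<gamma> x *v w)"
      by (rule tubular_diffeomorphism[OF \<open>open \<O>\<close> C1 \<open>inj_on \<tau> \<O>\<close> \<gamma>(1) _ _
            dim[unfolded add.commute[of "CARD('k)"]] T(1,2,4)])
        (use D(1) \<gamma>(2) in \<open>auto intro: that\<close>)
    with T(1,3) show ?thesis
      by (intro exI[of _ \<epsilon>]) (auto simp: open_Times closure_Times)
  qed
  with \<gamma>(1) show ?thesis
    unfolding Let_def by (intro exI[of _ \<gamma>]) auto
qed

end
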